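(* Let $\tilde F_n$ be the tilde-Fibonacci cube of order $n$. Then $|E(\tilde F_1)|=1$, $|E(\tilde F_2)|=3$ and, for all $n\ge 3$, $$|E(\tilde F_n)|=|E(\tilde F_{n-1})|+|E(\tilde F_{n-2})|+f_{n+1},$$ where $f_i$ denotes the $i$-th Fibonacci number.
   Context: Fibonacci numbers: $f_1=f_2=1$, $f_i=f_{i-1}+f_{i-2}$ for $i\ge3$. For binary words $u,v$ of equal length, the tilde-distance $\mathrm{dist}_\sim(u,v)$ is the minimum number of replacements (changing the symbol in one position to the opposite symbol) and swaps (exchanging two adjacent different symbols) needed to transform $u$ into $v$. The $n$-tilde-hypercube $\tilde Q_n$ is the (simple, undirected) graph whose vertices are the $2^n$ binary words of length $n$, two vertices being adjacent exactly when their tilde-distance is $1$. The tilde-Fibonacci cube $\tilde F_n$ of order $n\ge1$ is the subgraph of $\tilde Q_n$ obtained by removing all vertices that contain $11$ as a factor (contiguous subword), i.e. the subgraph induced on the words avoiding $11$. $E(G)$ denotes the edge set of a graph $G$. *)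

theory Defs
  imports "HOL-Library.Sublist" "HOL-Number_Theory.Fib"
begin

text \<open>Binary words are lists of type \<^typ>\<open>bool list\<close>, the symbol 1 being \<^const>\<open>True\<close>.\<close>

inductive tilde_step :: "bool list \<Rightarrow> bool list \<Rightarrow> bool" where
  replacement: "tilde_step (u @ [a] @ v) (u @ [\<not> a] @ v)"
| swap: "a \<noteq> b \<Longrightarrow> tilde_step (u @ [a, b] @ v) (u @ [b, a] @ v)"

text \<open>The minimum below is over a nonempty set whenever the two words have equal length;
  see \<open>tilde_step_reachable\<close>. For words of different length the value is irrelevant.\<close>

definition tilde_dist :: "bool list \<Rightarrow> bool list \<Rightarrow> nat" where
  "tilde_dist u v = (LEAST k. (tilde_step ^^ k) u v)"

record 'a ugraph =
  verts :: "'a set"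
  edges :: "'a set set"

definition remove_verts :: "'a ugraph \<Rightarrow> 'a set \<Rightarrow> 'a ugraph" where
  "remove_verts G S =
     \<lparr>verts = verts G - S, edges = {e \<in> edges G. e \<inter> S = {}}\<rparr>"

definition tilde_hypercube :: "nat \<Rightarrow> bool list ugraph" where
  "tilde_hypercube n =
     \<lparr>verts = {w. length w = n},
      edges = {{u, v} | u v. length u = n \<and> length v = n \<and> tilde_dist u v = 1}\<rparr>"

text \<open>\<^const>\<open>sublist\<close> is the contiguous-factor relation.\<close>

definition tilde_fib_cube :: "nat \<Rightarrow> bool list ugraph" where
  "tilde_fib_cube n = remove_verts (tilde_hypercube n) {w. sublist [True, True] w}"

lemma tilde_step_Cons: "tilde_step u v \<Longrightarrow> tilde_step (a # u) (a # v)"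
proof (induction rule: tilde_step.induct)
  case (replacement u b v)
  show ?case using tilde_step.replacement[of "a # u" b v] by simp
next
  case (swap b c u v)
  then show ?case using tilde_step.swap[of b c "a # u" v] by simp
qed

lemma tilde_step_reachable:
  assumes "length u = length v"
  shows "\<exists>k. (tilde_step ^^ k) u v"
proof -
  have lift: "tilde_step\<^sup>*\<^sup>* (a # xs) (a # ys)" if "tilde_step\<^sup>*\<^sup>* xs ys" for a xs ys
    using that by induction (auto intro: tilde_step_Cons rtranclp.rtrancl_into_rtrancl)
  have "tilde_step\<^sup>*\<^sup>* u v"
    using assms
  proof (induction u v rule: list_induct2)
    case Nil
    show ?case by simp
  next
    case (Cons a xs b ys)
    have "tilde_step\<^sup>*\<^sup>* (a # xs) (b # xs)"
      using tilde_step.replacement[of "[]" a xs] by (cases "a = b") auto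
    with lift[OF Cons.IH] show ?case by (rule rtranclp_trans[rotated])
  qed
  then show ?thesis by (simp add: rtranclp_power)
qed

end

theory Submission
  imports Defs
begin

text \<open>A vertex of the cube of order \<open>n + 2\<close> is \<open>0x\<close> or \<open>10w\<close>. Edges between two words of the
  same kind are copies of the edges of orders \<open>n + 1\<close> and \<open>n\<close>. Each word \<open>0x\<close> has exactly one
  neighbour of the other kind, obtained by replacing the first letter if \<open>x = 0w\<close> and by swapping
  the first two letters if \<open>x = 1w\<close>; in both cases the neighbour is \<open>10w\<close> where \<open>w\<close> is the tail of
  \<open>x\<close>. So the remaining edges correspond to the vertices of order \<open>n + 1\<close>.\<close>

lemma not_tilde_step_Nil [simp]: "\<not> tilde_step [] v" "\<not> tilde_step u []"
  by (auto elim: tilde_step.cases)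

text \<open>A step that touches the first letter changes it, either by replacing it or by swapping
  it with the second; any other step acts inside the tail. This gives a recursive test that stands
  in for the inductive rules from here on.\<close>

lemma tilde_step_Cons_iff:
  "tilde_step (a # x) (b # y) \<longleftrightarrow>
     (if a = b then tilde_step x y else x = y \<or> (\<exists>w. x = b # w \<and> y = a # w))"
proof
  assume "tilde_step (a # x) (b # y)"
  then show "if a = b then tilde_step x y else x = y \<or> (\<exists>w. x = b # w \<and> y = a # w)"
  proof cases
    case (replacement u c v)
    then show ?thesis
      \<comment> \<open>An empty prefix \<open>u\<close> means that the first letter is touched;
        otherwise the same move acts on the tail with prefix \<open>tl u\<close>.\<close>
      using tilde_step.replacement[of "tl u" c v] by (cases u) auto
  next
    case (swap c d u v)
    then show ?thesis
      using tilde_step.swap[of c d "tl u" v] by (cases u) auto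
  qed
next
  assume "if a = b then tilde_step x y else x = y \<or> (\<exists>w. x = b # w \<and> y = a # w)"
  then show "tilde_step (a # x) (b # y)"
    using tilde_step.replacement[of "[]" a x] tilde_step.swap[of a b "[]"]
    by (auto simp: tilde_step_Cons split: if_splits)
qed

lemma not_tilde_step_refl [simp]: "\<not> tilde_step u u"
  by (induction u) (auto simp: tilde_step_Cons_iff)

lemma tilde_step_sym: "tilde_step u v \<Longrightarrow> tilde_step v u"
proof (induction rule: tilde_step.induct)
  case (replacement u a v)
  show ?case using tilde_step.replacement[of u "\<not> a" v] by simp
next
  case (swap a b u v)
  then show ?case by (intro tilde_step.swap) simp
qed

text \<open>Equal lengths make the minimum an attained value, so distance 1 yields an actual step.
  Conversely, one step suffices, and zero steps would force \<open>u = v\<close>, although no step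
  fixes a word.\<close>

lemma tilde_dist_eq_1_iff:
  assumes "length u = length v"
  shows "tilde_dist u v = 1 \<longleftrightarrow> tilde_step u v"
proof
  assume "tilde_dist u v = 1"
  then show "tilde_step u v"
    using LeastI_ex[OF tilde_step_reachable[OF assms]] unfolding tilde_dist_def
    by (simp add: eq_OO)
next
  assume step: "tilde_step u v"
  show "tilde_dist u v = 1"
    unfolding tilde_dist_def
  proof (rule Least_equality)
    fix k assume "(tilde_step ^^ k) u v"
    with step show "1 \<le> k" by (cases k) auto
  qed (use step in \<open>simp add: eq_OO\<close>)
qed

text \<open>This is the vertex set of \<open>tilde_fib_cube n\<close>.\<close>

definition fib_words :: "nat \<Rightarrow> bool list set" where
  "fib_words n = {w. length w = n \<and> \<not> sublist [True, True] w}"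

lemma edges_tilde_fib_cube:
  "edges (tilde_fib_cube n) = {{u, v} | u v. u \<in> fib_words n \<and> v \<in> fib_words n \<and> tilde_step u v}"
proof -
  have "length u = n \<and> length v = n \<and> tilde_dist u v = 1 \<and> {u, v} \<inter> {w. sublist [True, True] w} = {}
      \<longleftrightarrow> u \<in> fib_words n \<and> v \<in> fib_words n \<and> tilde_step u v" for u v
    using tilde_dist_eq_1_iff[of u v] by (auto simp: fib_words_def)
  then have "edges (tilde_fib_cube n) = {e. \<exists>u v. e = {u, v} \<and>
      (u \<in> fib_words n \<and> v \<in> fib_words n \<and> tilde_step u v)}"
    unfolding tilde_fib_cube_def remove_verts_def tilde_hypercube_def ugraph.simps mem_Collect_eq
    by blast
  then show ?thesis .
qed

lemma finite_fib_words [simp]: "finite (fib_words n)"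
  by (rule finite_subset[OF _ finite_lists_length_eq[of UNIV n]]) (auto simp: fib_words_def)

lemma fib_words_0: "fib_words 0 = {[]}"
  by (auto simp: fib_words_def)

lemma False_Cons_fib_words_iff [simp]: "False # x \<in> fib_words (Suc n) \<longleftrightarrow> x \<in> fib_words n"
  by (auto simp: fib_words_def sublist_Cons_right)

text \<open>The only new place for the factor 11 is at the front. The case \<open>x = []\<close> is
  separate because \<open>hd []\<close> is unspecified.\<close>

lemma True_Cons_fib_words_iff [simp]:
  "True # x \<in> fib_words (Suc n) \<longleftrightarrow> x \<in> fib_words n \<and> (x = [] \<or> \<not> hd x)"
  by (cases x) (auto simp: fib_words_def sublist_Cons_right)

lemma fib_words_1: "fib_words (Suc 0) = {[False], [True]}"
proof -
  have "w \<in> fib_words (Suc 0) \<longleftrightarrow> w = [False] \<or> w = [True]" for w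
    by (auto simp: fib_words_def length_Suc_conv sublist_Cons_right)
  then show ?thesis by blast
qed

text \<open>As the length is at least 2, a leading 1 has a successor, which must be 0.\<close>

lemma fib_words_Suc_Suc:
  "fib_words (Suc (Suc n)) = (#) False ` fib_words (Suc n) \<union> (\<lambda>w. True # False # w) ` fib_words n"
  (is "?L = ?R")
proof
  show "?L \<subseteq> ?R"
  proof
    fix w assume w: "w \<in> ?L"
    then obtain a b x where "w = a # b # x" 
      by (auto simp: fib_words_def length_Suc_conv)
    with w show "w \<in> ?R" by (cases a; cases b) auto
  qed
qed auto

lemma tl_in_fib_words: "x \<in> fib_words (Suc n) \<Longrightarrow> tl x \<in> fib_words n"
  by (auto simp: fib_words_def length_Suc_conv sublist_Cons_right)

text \<open>The decomposition by first letter yields the Fibonacci recursion; the initial values 1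
  and 2 are \<open>fib 2\<close> and \<open>fib 3\<close>, hence the shift.\<close>

lemma card_fib_words: "card (fib_words n) = fib (n + 2)"
proof (induction n rule: fib.induct)
  case (3 n)
  have "card (fib_words (Suc (Suc n))) = card (fib_words (Suc n)) + card (fib_words n)"
    unfolding fib_words_Suc_Suc
    by (subst card_Un_disjoint) (auto simp: card_image inj_on_def)
  with 3 show ?case by simp
qed (simp_all add: fib_words_0 fib_words_1 numeral_2_eq_2)

lemma finite_edges_tilde_fib_cube [simp]: "finite (edges (tilde_fib_cube n))"
  by (rule finite_subset[of _ "Pow (fib_words n)"]) (auto simp: edges_tilde_fib_cube)

lemma edges_tilde_fib_cube_Suc_Suc:
  "edges (tilde_fib_cube (Suc (Suc n))) =
     (`) ((#) False) ` edges (tilde_fib_cube (Suc n))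
     \<union> (`) (\<lambda>w. True # False # w) ` edges (tilde_fib_cube n)
     \<union> (\<lambda>x. {False # x, True # False # tl x}) ` fib_words (Suc n)"
  (is "?L = ?A \<union> ?B \<union> ?C")
proof
  \<comment> \<open>The step forces \<open>x = False # w\<close> (replacement) or
    \<open>x = True # w\<close> (swap), so \<open>w = tl x\<close> either way.\<close>
  have cross: "{False # x, True # False # w} \<in> ?C"
    if "x \<in> fib_words (Suc n)" "tilde_step (False # x) (True # False # w)" for x w
  proof (rule image_eqI)
    show "{False # x, True # False # w} = {False # x, True # False # tl x}"
      using that(2) by (auto simp: tilde_step_Cons_iff)
  qed fact
  show "?L \<subseteq> ?A \<union> ?B \<union> ?C"
  proof
    fix e assume "e \<in> ?L"
    then obtain u v where e: "e = {u, v}" and u: "u \<in> fib_words (Suc (Suc n))"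
      and v: "v \<in> fib_words (Suc (Suc n))" and step: "tilde_step u v"
      by (auto simp: edges_tilde_fib_cube)
    from u consider (u0) x where "u = False # x" "x \<in> fib_words (Suc n)"
      | (u1) w where "u = True # False # w" "w \<in> fib_words n"
      by (auto simp: fib_words_Suc_Suc)
    then show "e \<in> ?A \<union> ?B \<union> ?C"
    proof cases
      case u0
      from v consider (v0) y where "v = False # y" "y \<in> fib_words (Suc n)"
        | (v1) w where "v = True # False # w" "w \<in> fib_words n"
        by (auto simp: fib_words_Suc_Suc)
      then show ?thesis
      proof cases
        case v0
        with u0 step have "{x, y} \<in> edges (tilde_fib_cube (Suc n))"
          by (auto simp: edges_tilde_fib_cube tilde_step_Cons_iff)
        then have "(#) False ` {x, y} \<in> ?A" by (rule imageI)
        with e u0 v0 show ?thesis by simp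
      next
        case v1
        with cross[of x w] e u0 step show ?thesis by blast
      qed
    next
      case u1
      from v consider (v0) y where "v = False # y" "y \<in> fib_words (Suc n)"
        | (v1) y where "v = True # False # y" "y \<in> fib_words n"
        by (auto simp: fib_words_Suc_Suc)
      then show ?thesis
      proof cases
        case v0
        \<comment> \<open>Edges are unordered, so the step is reversed to start at the word with
          leading 0.\<close>
        with cross[of y w] e u1 tilde_step_sym[OF step] show ?thesis
          by (simp add: insert_commute)
      next
        case v1
        with u1 step have "{w, y} \<in> edges (tilde_fib_cube n)"
          by (auto simp: edges_tilde_fib_cube tilde_step_Cons_iff)
        then have "(\<lambda>w. True # False # w) ` {w, y} \<in> ?B" by (rule imageI)
        with e u1 v1 show ?thesis by simp
      qed
    qed
  qed
  have edgeI: "{u, v} \<in> edges (tilde_fib_cube m)"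
    if "u \<in> fib_words m" "v \<in> fib_words m" "tilde_step u v" for u v m
    using that unfolding edges_tilde_fib_cube by blast
  have "?A \<subseteq> ?L"
  proof (rule image_subsetI)
    fix e assume "e \<in> edges (tilde_fib_cube (Suc n))"
    then obtain u v where "e = {u, v}" "u \<in> fib_words (Suc n)" "v \<in> fib_words (Suc n)"
        "tilde_step u v"
      unfolding edges_tilde_fib_cube by blast
    then show "(#) False ` e \<in> ?L"
      using edgeI[of "False # u" _ "False # v"] by (simp add: tilde_step_Cons_iff)
  qed
  moreover have "?B \<subseteq> ?L"
  proof (rule image_subsetI)
    fix e assume "e \<in> edges (tilde_fib_cube n)"
    then obtain u v where "e = {u, v}" "u \<in> fib_words n" "v \<in> fib_words n" "tilde_step u v"
      unfolding edges_tilde_fib_cube by blast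
    then show "(\<lambda>w. True # False # w) ` e \<in> ?L"
      using edgeI[of "True # False # u" _ "True # False # v"] by (simp add: tilde_step_Cons_iff)
  qed
  moreover have "?C \<subseteq> ?L"
  proof
    fix e assume "e \<in> ?C"
    then obtain x where e: "e = {False # x, True # False # tl x}" and x: "x \<in> fib_words (Suc n)"
      by blast
    from x have "x \<noteq> []" by (auto simp: fib_words_def)
    then have "tilde_step (False # x) (True # False # tl x)"
      \<comment> \<open>The first letter of \<open>x\<close> decides between a replacement (0) and a
        swap (1).\<close>
      by (cases x) (auto simp: tilde_step_Cons_iff)
    moreover have "True # False # tl x \<in> fib_words (Suc (Suc n))"
      using tl_in_fib_words[OF x] by simp
    moreover have "False # x \<in> fib_words (Suc (Suc n))"
      using x by simp
    ultimately show "e \<in> ?L"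
      unfolding e by (intro edgeI)
  qed
  ultimately show "?A \<union> ?B \<union> ?C \<subseteq> ?L" by (intro Un_least)
qed

lemma card_edges_tilde_fib_cube_Suc_Suc:
  "card (edges (tilde_fib_cube (Suc (Suc n)))) =
     card (edges (tilde_fib_cube (Suc n))) + card (edges (tilde_fib_cube n)) + fib (n + 3)"
proof -
  let ?A = "(`) ((#) False) ` edges (tilde_fib_cube (Suc n))"
  let ?B = "(`) (\<lambda>w. True # False # w) ` edges (tilde_fib_cube n)"
  let ?C = "(\<lambda>x. {False # x, True # False # tl x}) ` fib_words (Suc n)"
  have "card ?A = card (edges (tilde_fib_cube (Suc n)))"
    by (intro card_image inj_onI) (simp add: inj_image_eq_iff inj_def)
  moreover have "card ?B = card (edges (tilde_fib_cube n))"
    by (intro card_image inj_onI) (simp add: inj_image_eq_iff inj_def)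
  moreover have "card ?C = fib (n + 3)"
    \<comment> \<open>In such a pair, \<open>False # x\<close> is the only word with leading 0, so
      the pair determines \<open>x\<close>.\<close>
    by (subst card_image) (auto simp: inj_on_def doubleton_eq_iff card_fib_words numeral_3_eq_3)
  moreover have "?A \<inter> ?B = {}" "(?A \<union> ?B) \<inter> ?C = {}"
  proof -
    have ne: "e \<noteq> {}" if "e \<in> edges (tilde_fib_cube m)" for e m
      using that by (auto simp: edges_tilde_fib_cube)
    have A: "hd ` e = {False}" if "e \<in> ?A" for e
      using that by (elim imageE) (simp add: image_image image_constant_conv ne)
    have B: "hd ` e = {True}" if "e \<in> ?B" for e
      using that by (elim imageE) (simp add: image_image image_constant_conv ne)
    have C: "hd ` e = {False, True}" if "e \<in> ?C" for e
      using that by (elim imageE) simp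
    have AB: False if "e \<in> ?A" "e \<in> ?B" for e
      using A[OF that(1)] B[OF that(2)] by simp
    have AC: False if "e \<in> ?A" "e \<in> ?C" for e
      using trans[OF A[OF that(1), symmetric] C[OF that(2)]] by simp
    have BC: False if "e \<in> ?B" "e \<in> ?C" for e
      using trans[OF B[OF that(1), symmetric] C[OF that(2)]] by simp
    show "?A \<inter> ?B = {}"
      unfolding disjoint_iff using AB by iprover
    show "(?A \<union> ?B) \<inter> ?C = {}"
      unfolding disjoint_iff Un_iff using AC BC by iprover
  qed
  ultimately show ?thesis
    unfolding edges_tilde_fib_cube_Suc_Suc by (simp add: card_Un_disjoint)
qed

theorem corollary25:
  shows "card (edges (tilde_fib_cube 1)) = 1
       \<and> card (edges (tilde_fib_cube 2)) = 3
       \<and> (\<forall>n\<ge>3. card (edges (tilde_fib_cube n))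
            = card (edges (tilde_fib_cube (n - 1)))
              + card (edges (tilde_fib_cube (n - 2))) + fib (n + 1))"
proof (intro conjI allI impI)
  \<comment> \<open>The recursion already holds from order 0, whose single vertex is the empty word;
    order 2 therefore has 1 + 0 + \<open>fib 3\<close> = 3 edges.\<close>
  have "edges (tilde_fib_cube 0) = {}"
    by (auto simp: edges_tilde_fib_cube fib_words_0)
  moreover have "edges (tilde_fib_cube (Suc 0)) = {{[False], [True]}}"
  proof -
    have "tilde_step [False] [True]" by (simp add: tilde_step_Cons_iff)
    then show ?thesis
      unfolding edges_tilde_fib_cube fib_words_1 by auto
  qed
  ultimately show "card (edges (tilde_fib_cube 1)) = 1" "card (edges (tilde_fib_cube 2)) = 3"
    using card_edges_tilde_fib_cube_Suc_Suc[of 0] by (simp_all add: numeral_2_eq_2 numeral_3_eq_3)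
next
  fix n :: nat
  assume "3 \<le> n"
  then obtain m where "n = Suc (Suc m)"
    by (metis One_nat_def Suc_1 Suc_le_D Suc_le_mono numeral_3_eq_3)
  then show "card (edges (tilde_fib_cube n)) = card (edges (tilde_fib_cube (n - 1)))
      + card (edges (tilde_fib_cube (n - 2))) + fib (n + 1)"
    using card_edges_tilde_fib_cube_Suc_Suc[of m] by (simp add: numeral_3_eq_3)
qed

end
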